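(* Let $T$ be an up or down rule on an $I$-graded poset $\Omega$. Suppose there are sequences $(\check{b}_i\in\ell_1^+(\Omega_i))_{i\in I}$ and $(\hat{b}_i\in\ell_1^+(\Omega_i))_{i\in I}$ such that for any $m\le n$ in $I$ there exists a $T$-sequence $(\pi_i)_{i\in[m,n]}$ with $\check{b}_i\le\pi_i\le\hat{b}_i$ for any $i\in[m,n]$. Then there exists a positive maximal $T$-sequence, i.e. a $T$-sequence $(\pi_i)_{i\in I}$ with index interval $I$ such that $\pi_i(u)>0$ for every $i\in I$ and every $u\in\Omega_i$.
   Context: Let $I\subseteq\mathbb{Z}$ be a (possibly infinite) nonempty interval of integers. An $I$-graded poset $\Omega$ is a countable (or finite) poset with a surjective map $\rho\colon\Omega\to I$ (the rank function) such that $u<v$ implies $\rho(u)<\rho(v)$, and $u\lessdot v$ implies $\rho(v)=\rho(u)+1$. Here $u\lessdot v$ means that $v$ covers $u$. The level sets are $\Omega_i=\rho^{-1}(i)$. An up rule on $\Omega$ is an assignment of a probability $T(u\rightarrow v)\in[0,1]$ to each pair $(u,v)\in\Omega\times\Omega$ such that $T(u\rightarrow v)>0\Leftrightarrow u\lessdot v$, and $\sum_{v\in\Omega}T(u\rightarrow v)=1$ for every $u$ of non-maximal rank. A down rule is such an assignment with $T(u\rightarrow v)>0\Leftrightarrow v\lessdot u$, and $\sum_{v\in\Omega}T(u\rightarrow v)=1$ for every $u$ of non-minimal rank. $\ell_1(\Omega)$ is the Banach space of functions $f\colon\Omega\to\mathbb{R}$ with $\|f\|=\sum_{u}|f(u)|<\infty$.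 $\ell_1(\Omega_i)$ is the subspace of functions vanishing outside $\Omega_i$. $\ell_1^+(\Omega_i)=\{f\in\ell_1(\Omega_i): f(u)>0\text{ for any }u\in\Omega_i\}$. $M(\Omega_i)$ is the set of $\pi\in\ell_1(\Omega_i)$ that are nonnegative with $\sum_{u\in\Omega_i}\pi(u)=1$. For $f,g\in\ell_1(\Omega)$, $f\le g$ means $f(u)\le g(u)$ for all $u\in\Omega$. $T$ induces a linear operator on $\ell_1(\Omega)$ by $(T\pi)(v)=\sum_{u\in\Omega}T(u\rightarrow v)\pi(u)$. For an interval $J\subseteq I$, a sequence $(\pi_i\in M(\Omega_i))_{i\in J}$ is a $T$-sequence if, when $T$ is an up rule, $T\pi_i=\pi_{i+1}$ for every non-maximal $i\in J$, and, when $T$ is a down rule, $T\pi_i=\pi_{i-1}$ for every non-minimal $i\in J$. *)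

theory Defs
  imports "HOL-Analysis.Infinite_Sum" "HOL-Library.Countable"
begin

definition int_interval :: "int set \<Rightarrow> bool" where
  "int_interval J \<longleftrightarrow> (\<forall>a\<in>J. \<forall>b\<in>J. {a..b} \<subseteq> J)"

definition covered_by :: "'a::order \<Rightarrow> 'a \<Rightarrow> bool" where
  "covered_by u v \<longleftrightarrow> u < v \<and> (\<nexists>w. u < w \<and> w < v)"

text \<open>The poset is the whole type; class \<open>countable\<close> includes the finite types.\<close>

definition graded_poset :: "int set \<Rightarrow> ('a::{order, countable} \<Rightarrow> int) \<Rightarrow> bool" where
  "graded_poset I \<rho> \<longleftrightarrow>
     I \<noteq> {} \<and> int_interval I \<and> range \<rho> = I \<and>
     (\<forall>u v. u < v \<longrightarrow> \<rho> u < \<rho> v) \<and>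
     (\<forall>u v. covered_by u v \<longrightarrow> \<rho> v = \<rho> u + 1)"

definition level :: "('a \<Rightarrow> int) \<Rightarrow> int \<Rightarrow> 'a set" where
  "level \<rho> i = {u. \<rho> u = i}"

definition up_rule :: "int set \<Rightarrow> ('a::{order, countable} \<Rightarrow> int) \<Rightarrow> ('a \<Rightarrow> 'a \<Rightarrow> real) \<Rightarrow> bool" where
  "up_rule I \<rho> T \<longleftrightarrow>
     (\<forall>u v. T u v \<in> {0..1}) \<and>
     (\<forall>u v. T u v > 0 \<longleftrightarrow> covered_by u v) \<and>
     (\<forall>u. (\<exists>j\<in>I. \<rho> u < j) \<longrightarrow> (T u has_sum 1) UNIV)"

definition down_rule :: "int set \<Rightarrow> ('a::{order, countable} \<Rightarrow> int) \<Rightarrow> ('a \<Rightarrow> 'a \<Rightarrow> real) \<Rightarrow> bool" where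
  "down_rule I \<rho> T \<longleftrightarrow>
     (\<forall>u v. T u v \<in> {0..1}) \<and>
     (\<forall>u v. T u v > 0 \<longleftrightarrow> covered_by v u) \<and>
     (\<forall>u. (\<exists>j\<in>I. j < \<rho> u) \<longrightarrow> (T u has_sum 1) UNIV)"

definition l1 :: "('a \<Rightarrow> real) set" where
  "l1 = {f. (\<lambda>u. \<bar>f u\<bar>) summable_on UNIV}"

definition l1_level :: "('a \<Rightarrow> int) \<Rightarrow> int \<Rightarrow> ('a \<Rightarrow> real) set" where
  "l1_level \<rho> i = {f \<in> l1. \<forall>u. u \<notin> level \<rho> i \<longrightarrow> f u = 0}"

definition l1_level_pos :: "('a \<Rightarrow> int) \<Rightarrow> int \<Rightarrow> ('a \<Rightarrow> real) set" where
  "l1_level_pos \<rho> i = {f \<in> l1_level \<rho> i. \<forall>u\<in>level \<rho> i. f u > 0}"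

definition prob_level :: "('a \<Rightarrow> int) \<Rightarrow> int \<Rightarrow> ('a \<Rightarrow> real) set" where
  "prob_level \<rho> i = {f \<in> l1_level \<rho> i. (\<forall>u. f u \<ge> 0) \<and> (f has_sum 1) (level \<rho> i)}"

text \<open>For an up or down rule \<open>T\<close> and \<open>f \<in> l1\<close> the sum converges absolutely, since \<open>0 \<le> T u v \<le> 1\<close>.\<close>

definition rule_op :: "('a \<Rightarrow> 'a \<Rightarrow> real) \<Rightarrow> ('a \<Rightarrow> real) \<Rightarrow> 'a \<Rightarrow> real" where
  "rule_op T f v = (\<Sum>\<^sub>\<infinity>u. T u v * f u)"

text \<open>Only the values \<open>\<pi> i\<close> with \<open>i \<in> J\<close> matter.  If \<open>T\<close> is both an up rule and a down rule
  then \<open>I\<close> is a singleton and both step conditions are vacuous.\<close>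

definition T_sequence ::
    "int set \<Rightarrow> ('a::{order, countable} \<Rightarrow> int) \<Rightarrow> ('a \<Rightarrow> 'a \<Rightarrow> real) \<Rightarrow> int set \<Rightarrow>
     (int \<Rightarrow> 'a \<Rightarrow> real) \<Rightarrow> bool" where
  "T_sequence I \<rho> T J \<pi> \<longleftrightarrow>
     int_interval J \<and> J \<subseteq> I \<and>
     (\<forall>i\<in>J. \<pi> i \<in> prob_level \<rho> i) \<and>
     (up_rule I \<rho> T \<longrightarrow> (\<forall>i\<in>J. (\<exists>j\<in>J. i < j) \<longrightarrow> rule_op T (\<pi> i) = \<pi> (i + 1))) \<and>
     (down_rule I \<rho> T \<longrightarrow> (\<forall>i\<in>J. (\<exists>j\<in>J. j < i) \<longrightarrow> rule_op T (\<pi> i) = \<pi> (i - 1)))"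

end

theory Submission
  imports Defs "HOL-Analysis.Function_Metric" "HOL-Analysis.Infinite_Set_Sum"
begin

text \<open>
  The proof is a compactness argument.  Exhaust \<open>I\<close> by finite integer intervals and take on each of
  them a \<open>T\<close>-sequence lying between the two barriers.  The values \<open>\<pi>\<^sub>k i u\<close> are indexed by the countable
  set of pairs \<open>(i, u)\<close> and are bounded at each pair, so a subsequence converges at every pair
  (\<open>pointwise_convergent_subsequence\<close>).  The limit is the required sequence, and each
  barrier has its own task:

  \<^item> The upper barrier is summable, so no mass escapes in the limit.  By dominated convergence
    (\<open>infsum_dominated_convergence\<close>) the limits are again probability distributions
    (\<open>prob_level_limit\<close>), and the operator of \<open>T\<close> commutes with the limit (\<open>rule_op_tendsto\<close>), so the
    relations \<open>T \<pi>\<^sub>i = \<pi>\<^sub>i\<^sub>\<plusminus>\<^sub>1\<close> survive.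
  \<^item> The lower barrier is positive and bounds the limit from below, which gives positivity.

  Up rules and down rules are treated alike, because passing to the limit concerns one relation
  between two neighbouring levels at a time.
\<close>

section \<open>Compactness and dominated convergence\<close>

text \<open>
  By Tychonoff a product of compact intervals is compact.  Over a countable index type the product
  topology is metrizable, so compactness gives convergent subsequences; this replaces an explicit
  diagonal argument.
\<close>

lemma pointwise_convergent_subsequence:
  fixes x :: "nat \<Rightarrow> 'b::countable \<Rightarrow> real"
  assumes bound: "\<And>k p. x k p \<in> {lo p..hi p}"
  obtains l r where "strict_mono (r :: nat \<Rightarrow> nat)" "\<And>p. (\<lambda>k. x (r k) p) \<longlonglongrightarrow> l p"
proof -
  let ?K = "PiE UNIV (\<lambda>p. {lo p..hi p})"
  have "compactin (product_topology (\<lambda>_. euclidean) UNIV) ?K"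
    by (simp add: compactin_PiE)
  then have "compact ?K"
    by (simp add: euclidean_product_topology)
  then have "seq_compact ?K"
    by (simp add: compact_imp_seq_compact)
  moreover have "\<forall>k. x k \<in> ?K"
    using bound by auto
  ultimately obtain l r where r: "strict_mono (r :: nat \<Rightarrow> nat)" and lim: "(x \<circ> r) \<longlonglongrightarrow> l"
    unfolding seq_compact_def by blast
  have "(\<lambda>k. x (r k) p) \<longlonglongrightarrow> l p" for p
    using continuous_on_tendsto_compose[OF continuous_on_product_coordinates[of p] lim]
    by (simp add: o_def)
  with r show thesis
    by (rule that)
qed

lemma infsum_dominated_convergence:
  fixes f :: "nat \<Rightarrow> 'b \<Rightarrow> real"
  assumes g: "g summable_on A"
    and bound: "\<And>k u. u \<in> A \<Longrightarrow> \<bar>f k u\<bar> \<le> g u"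
    and lim: "\<And>u. u \<in> A \<Longrightarrow> (\<lambda>k. f k u) \<longlonglongrightarrow> l u"
  shows "l summable_on A" and "(\<lambda>k. infsum (f k) A) \<longlonglongrightarrow> infsum l A"
proof -
  have g_nonneg: "g u \<ge> 0" if "u \<in> A" for u
    using bound[OF that, of 0] by linarith
  have l_bound: "\<bar>l u\<bar> \<le> g u" if "u \<in> A" for u
    by (rule tendsto_upperbound[OF tendsto_rabs[OF lim[OF that]]]) (use bound that in auto)
  have "(\<lambda>u. norm (g u)) summable_on A"
    using g by (rule summable_on_cong[THEN iffD1, rotated]) (simp add: g_nonneg)
  then have g_int: "Infinite_Set_Sum.abs_summable_on g A"
    by (rule abs_summable_equivalent[THEN iffD1])
  have f_int: "Infinite_Set_Sum.abs_summable_on (f k) A" for k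
    by (rule abs_summable_on_comparison_test[OF g_int]) (simp add: bound g_nonneg)
  have l_int: "Infinite_Set_Sum.abs_summable_on l A"
    by (rule abs_summable_on_comparison_test[OF g_int]) (simp add: l_bound g_nonneg)
  then show "l summable_on A"
    using abs_summable_equivalent abs_summable_summable by blast
  have "(\<lambda>k. infsetsum (f k) A) \<longlonglongrightarrow> infsetsum l A"
    unfolding infsetsum_def
  proof (rule integral_dominated_convergence[where w = g])
    show "integrable (count_space A) g"
      using g_int by (simp add: abs_summable_on_def)
  qed (use bound lim in \<open>auto intro!: AE_I2\<close>)
  then show "(\<lambda>k. infsum (f k) A) \<longlonglongrightarrow> infsum l A"
    using f_int l_int by (simp add: infsetsum_infsum)
qed

section \<open>Limits of dominated distributions\<close>

lemma l1_level_summable: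
  assumes "g \<in> l1_level \<rho> i"
  shows "g summable_on UNIV"
  using assms by (auto simp: l1_level_def l1_def intro: abs_summable_summable)

text \<open>Pointwise limits of distributions may lose mass in general; the summable bound excludes this.\<close>

lemma prob_level_limit:
  assumes g: "g \<in> l1_level \<rho> i"
    and f: "\<And>k. f k \<in> prob_level \<rho> i" "\<And>k. f k \<le> g"
    and lim: "\<And>u. (\<lambda>k. f k u) \<longlonglongrightarrow> l u"
  shows "l \<in> prob_level \<rho> i"
proof -
  have f_nonneg: "f k u \<ge> 0" for k u
    using f(1) by (auto simp: prob_level_def)
  have bound: "\<bar>f k u\<bar> \<le> g u" for k u
    using f_nonneg f(2) by (auto simp: le_fun_def)
  have l_nonneg: "l u \<ge> 0" for u
    by (rule tendsto_lowerbound[OF lim]) (use f_nonneg in auto)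
  have l_zero: "l u = 0" if "u \<notin> level \<rho> i" for u
  proof -
    have "f k u = 0" for k
      using f(1)[of k] that by (auto simp: prob_level_def l1_level_def)
    with lim[of u] show ?thesis
      by (simp add: LIMSEQ_const_iff)
  qed
  note g_summable = l1_level_summable[OF g]
  have "l summable_on UNIV"
    by (rule infsum_dominated_convergence(1)[OF g_summable bound lim])
  then have "l \<in> l1"
    using l_nonneg by (simp add: l1_def)
  moreover have "(l has_sum 1) (level \<rho> i)"
  proof -
    have g_level: "g summable_on level \<rho> i"
      using g_summable summable_on_subset_banach by blast
    have "infsum (f k) (level \<rho> i) = 1" for k
      using f(1)[of k] by (auto simp: prob_level_def intro: infsumI)
    moreover have "(\<lambda>k. infsum (f k) (level \<rho> i)) \<longlonglongrightarrow> infsum l (level \<rho> i)"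
      by (rule infsum_dominated_convergence(2)[OF g_level bound lim])
    ultimately have "infsum l (level \<rho> i) = 1"
      by (simp add: LIMSEQ_const_iff)
    moreover have "l summable_on level \<rho> i"
      by (rule infsum_dominated_convergence(1)[OF g_level bound lim])
    ultimately show ?thesis
      by (metis has_sum_infsum)
  qed
  ultimately show ?thesis
    using l_nonneg l_zero by (auto simp: prob_level_def l1_level_def)
qed

lemma rule_op_tendsto:
  assumes T: "\<And>u v. T u v \<in> {0..1}"
    and g: "g \<in> l1_level \<rho> i"
    and f: "\<And>k. f k \<in> prob_level \<rho> i" "\<And>k. f k \<le> g"
    and lim: "\<And>u. (\<lambda>k. f k u) \<longlonglongrightarrow> l u"
  shows "(\<lambda>k. rule_op T (f k) v) \<longlonglongrightarrow> rule_op T l v"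
  unfolding rule_op_def
proof (rule infsum_dominated_convergence(2)[OF l1_level_summable[OF g]])
  fix k u
  have "0 \<le> f k u" "f k u \<le> g u"
    using f by (auto simp: prob_level_def le_fun_def)
  moreover have "0 \<le> T u v" "T u v \<le> 1"
    using T by auto
  ultimately show "\<bar>T u v * f k u\<bar> \<le> g u"
    using mult_left_le_one_le[of "f k u" "T u v"] by (simp add: abs_mult)
  show "(\<lambda>k. T u v * f k u) \<longlonglongrightarrow> T u v * l u"
    by (intro tendsto_intros lim)
qed

section \<open>Exhaustion by finite intervals\<close>

text \<open>
  A bounded window of \<open>I\<close> has both end points in \<open>I\<close>, so a hypothesis about intervals with end points
  in \<open>I\<close> applies to it.
\<close>

lemma int_interval_window:
  assumes "int_interval I" "i0 \<in> I"
  obtains m n where "m \<in> I" "n \<in> I" "m \<le> n" "I \<inter> {i0 - int k..i0 + int k} = {m..n}"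
proof -
  let ?W = "I \<inter> {i0 - int k..i0 + int k}"
  have fin: "finite ?W" and "i0 \<in> ?W"
    using assms by auto
  then have ne: "?W \<noteq> {}"
    by blast
  have Min: "Min ?W \<in> ?W" and Max: "Max ?W \<in> ?W"
    using Min_in[OF fin ne] Max_in[OF fin ne] by blast+
  have "{Min ?W..Max ?W} \<subseteq> I"
    using assms(1) Min Max unfolding int_interval_def by blast
  then have "{Min ?W..Max ?W} \<subseteq> ?W"
    using Min Max by auto
  moreover have "?W \<subseteq> {Min ?W..Max ?W}"
    using fin by auto
  ultimately show thesis
    using that[of "Min ?W" "Max ?W"] Min Max Min_le[OF fin Max] by blast
qed

theorem theorem5:
  fixes I :: "int set"
    and \<rho> :: "'a::{order, countable} \<Rightarrow> int"
    and T :: "'a \<Rightarrow> 'a \<Rightarrow> real"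
    and b_lo b_hi :: "int \<Rightarrow> 'a \<Rightarrow> real"
  assumes "graded_poset I \<rho>"
    and "up_rule I \<rho> T \<or> down_rule I \<rho> T"
    and "\<forall>i\<in>I. b_lo i \<in> l1_level_pos \<rho> i"
    and "\<forall>i\<in>I. b_hi i \<in> l1_level_pos \<rho> i"
    and "\<forall>m\<in>I. \<forall>n\<in>I. m \<le> n \<longrightarrow>
           (\<exists>\<pi>. T_sequence I \<rho> T {m..n} \<pi> \<and>
                (\<forall>i\<in>{m..n}. b_lo i \<le> \<pi> i \<and> \<pi> i \<le> b_hi i))"
  shows "\<exists>\<pi>. T_sequence I \<rho> T I \<pi> \<and> (\<forall>i\<in>I. \<forall>u\<in>level \<rho> i. \<pi> i u > 0)"
proof -
  from assms(1) have int: "int_interval I" and "I \<noteq> {}"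
    by (auto simp: graded_poset_def)
  then obtain i0 where i0: "i0 \<in> I"
    by blast
  have T: "\<And>u v. T u v \<in> {0..1}"
    using assms(2) by (auto simp: up_rule_def down_rule_def)
  have hi: "b_hi i \<in> l1_level \<rho> i" if "i \<in> I" for i
    using assms(4) that by (auto simp: l1_level_pos_def)

  define W where "W k = I \<inter> {i0 - int k..i0 + int k}" for k
  have "\<exists>\<pi>. T_sequence I \<rho> T (W k) \<pi> \<and> (\<forall>i\<in>W k. b_lo i \<le> \<pi> i \<and> \<pi> i \<le> b_hi i)" for k
    unfolding W_def by (rule int_interval_window[OF int i0, of k]) (use assms(5) in auto)
  then obtain \<pi> where seq: "\<And>k. T_sequence I \<rho> T (W k) (\<pi> k)"
    and between: "\<And>k i. i \<in> W k \<Longrightarrow> b_lo i \<le> \<pi> k i \<and> \<pi> k i \<le> b_hi i"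
    by metis
  have prob: "\<pi> k i \<in> prob_level \<rho> i" if "i \<in> W k" for k i
    using seq that by (auto simp: T_sequence_def)

  \<comment> \<open>Outside its window a sequence is extended by 0, to have one family of functions on all pairs.\<close>
  define x where "x k p = (if fst p \<in> W k then \<pi> k (fst p) (snd p) else 0)"
    for k and p :: "int \<times> 'a"
  have x_bound: "x k p \<in> {0..max 0 (b_hi (fst p) (snd p))}" for k p
    using prob[of "fst p" k] between[of "fst p" k]
    by (auto simp: x_def prob_level_def le_fun_def le_max_iff_disj)
  obtain l r where r: "strict_mono (r :: nat \<Rightarrow> nat)" and lim: "\<And>p. (\<lambda>k. x (r k) p) \<longlonglongrightarrow> l p"
    using pointwise_convergent_subsequence[of x, OF x_bound] by blast
  define \<sigma> where "\<sigma> i u = l (i, u)" for i u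

  \<comment> \<open>The windows increase, so from the index \<open>\<bar>i - i0\<bar>\<close> on all of them contain \<open>i\<close>;
    dropping the first terms leaves genuine distributions only.\<close>
  have window: "i \<in> W (r (k + N))" if "i \<in> I" "nat \<bar>i - i0\<bar> \<le> N" for i k N
    using that seq_suble[OF r, of "k + N"] by (auto simp: W_def)
  have \<sigma>_lim: "(\<lambda>k. \<pi> (r (k + N)) i u) \<longlonglongrightarrow> \<sigma> i u" if "i \<in> I" "nat \<bar>i - i0\<bar> \<le> N" for i u N
    using LIMSEQ_ignore_initial_segment[OF lim[of "(i, u)"], of N] window[OF that]
    by (simp add: x_def \<sigma>_def)

  have \<sigma>_prob: "\<sigma> i \<in> prob_level \<rho> i" if "i \<in> I" for i
    by (rule prob_level_limit[OF hi[OF that] _ _ \<sigma>_lim[OF that order_refl]])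
       (use prob between window[OF that order_refl] in blast)+

  \<comment> \<open>Both kinds of step are covered at once: \<open>j\<close> is the neighbour of \<open>i\<close> in the direction of \<open>T\<close>.\<close>
  have step: "rule_op T (\<sigma> i) = \<sigma> j"
    if i: "i \<in> I" and j: "j \<in> I"
      and *: "\<And>k. i \<in> W k \<Longrightarrow> j \<in> W k \<Longrightarrow> rule_op T (\<pi> k i) = \<pi> k j" for i j
  proof
    fix v
    define N where "N = max (nat \<bar>i - i0\<bar>) (nat \<bar>j - i0\<bar>)"
    have iN: "nat \<bar>i - i0\<bar> \<le> N" and jN: "nat \<bar>j - i0\<bar> \<le> N"
      by (auto simp: N_def)
    have "(\<lambda>k. rule_op T (\<pi> (r (k + N)) i) v) \<longlonglongrightarrow> rule_op T (\<sigma> i) v"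
      by (rule rule_op_tendsto[OF T hi[OF i] _ _ \<sigma>_lim[OF i iN]])
         (use prob between window[OF i iN] in blast)+
    moreover have "(\<lambda>k. rule_op T (\<pi> (r (k + N)) i) v) \<longlonglongrightarrow> \<sigma> j v"
      using \<sigma>_lim[OF j jN] *[OF window[OF i iN] window[OF j jN]] by simp
    ultimately show "rule_op T (\<sigma> i) v = \<sigma> j v"
      by (rule LIMSEQ_unique)
  qed
  have up: "rule_op T (\<sigma> i) = \<sigma> (i + 1)" if "up_rule I \<rho> T" "i \<in> I" "j \<in> I" "i < j" for i j
  proof (rule step)
    show "i + 1 \<in> I"
      using int that unfolding int_interval_def by force
    show "rule_op T (\<pi> k i) = \<pi> k (i + 1)" if "i \<in> W k" "i + 1 \<in> W k" for k
      using seq[of k] \<open>up_rule I \<rho> T\<close> that unfolding T_sequence_def by force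
  qed fact
  have down: "rule_op T (\<sigma> i) = \<sigma> (i - 1)" if "down_rule I \<rho> T" "i \<in> I" "j \<in> I" "j < i" for i j
  proof (rule step)
    show "i - 1 \<in> I"
      using int that unfolding int_interval_def by force
    show "rule_op T (\<pi> k i) = \<pi> k (i - 1)" if "i \<in> W k" "i - 1 \<in> W k" for k
      using seq[of k] \<open>down_rule I \<rho> T\<close> that unfolding T_sequence_def by force
  qed fact

  have "T_sequence I \<rho> T I \<sigma>"
    unfolding T_sequence_def using int \<sigma>_prob up down by blast
  moreover have "\<sigma> i u > 0" if i: "i \<in> I" and u: "u \<in> level \<rho> i" for i u
  proof -
    have "b_lo i u \<le> \<sigma> i u"
      by (rule tendsto_lowerbound[OF \<sigma>_lim[OF i order_refl]])
         (use between window[OF i order_refl] in \<open>auto simp: le_fun_def\<close>)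
    moreover have "b_lo i u > 0"
      using assms(3) i u by (auto simp: l1_level_pos_def)
    ultimately show ?thesis
      by linarith
  qed
  ultimately show ?thesis
    by blast
qed

end
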